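(* Let $G$ be a unicyclic graph with $n$ vertices and let $C_{\ell}$ (of length $\ell$) be the unique cycle in $G$. Then $$\eta_{per}(G)=\begin{cases} n-2\nu(G)-1 & \text{if } \ell \text{ is odd and } \nu(G)=\frac{\ell-1}{2}+\nu(G-C_{\ell}),\\ n-2\nu(G) & \text{otherwise.}\end{cases}$$
   Context: All graphs are finite and simple. A unicyclic graph is a connected graph with equal numbers of vertices and edges; it contains exactly one cycle. $G-C_\ell$ is the graph obtained from $G$ by deleting all vertices of $C_\ell$. $\nu(H)$ is the matching number of a graph $H$, i.e. the size of a maximum matching (with $\nu=0$ for the graph with no vertices). For a graph $G$ with $n$ vertices and adjacency matrix $A(G)$, the permanental polynomial is $\pi(G,x)=\mathrm{per}(xI-A(G))$, where $\mathrm{per}(A)=\sum_{\sigma}\prod_{i=1}^n a_{i\sigma(i)}$ with $\sigma$ ranging over all permutations of $\{1,\dots,n\}$. The permanental nullity $\eta_{per}(G)$ is the multiplicity of $0$ as a root of $\pi(G,x)$ (it is $0$ if $0$ is not a root). *)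

theory Defs
  imports
    "Graph_Theory.Graph_Theory"
    "HOL-Combinatorics.Permutations"
    "HOL-Computational_Algebra.Polynomial"
begin

text \<open>
  The locale \<^locale>\<open>graph\<close> describes the finite simple graphs: finite, loop-free, symmetric and
  without parallel arcs. An undirected edge there consists of two opposite arcs, so the edges
  are counted as unordered pairs of adjacent vertices.
\<close>

definition edges :: "('a,'b) pre_digraph \<Rightarrow> 'a set set" where
  "edges G = {{u, v} | u v. u \<rightarrow>\<^bsub>G\<^esub> v}"

definition unicyclic :: "('a,'b) pre_digraph \<Rightarrow> bool" where
  "unicyclic G \<longleftrightarrow> graph G \<and> connected G \<and> card (edges G) = card (verts G)"

text \<open>
  The bound on the length is needed because \<^const>\<open>pre_digraph.cycle\<close> also admits the closed walk
  that runs back and forth along one edge.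
\<close>

definition cycle_graph :: "('a,'b) pre_digraph \<Rightarrow> bool" where
  "cycle_graph C \<longleftrightarrow> graph C \<and>
     (\<exists>p. pre_digraph.cycle C p \<and> 3 \<le> length p \<and> verts C = tail C ` set p \<and>
          edges C = (\<lambda>a. {tail C a, head C a}) ` set p)"

definition del_verts :: "('a,'b) pre_digraph \<Rightarrow> 'a set \<Rightarrow> ('a,'b) pre_digraph" where
  "del_verts G S = G \<restriction> (verts G - S)"

definition matching :: "('a,'b) pre_digraph \<Rightarrow> 'a set set \<Rightarrow> bool" where
  "matching G M \<longleftrightarrow> M \<subseteq> edges G \<and> pairwise disjnt M"

definition matching_number :: "('a,'b) pre_digraph \<Rightarrow> nat" where
  "matching_number G = Max (card ` {M. matching G M})"

text \<open>
  Matrices are indexed by the vertices themselves instead of by an enumeration of them; the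
  permanent does not depend on the enumeration.
\<close>

definition permanent :: "'i set \<Rightarrow> ('i \<Rightarrow> 'i \<Rightarrow> 'c::comm_ring_1) \<Rightarrow> 'c" where
  "permanent I A = (\<Sum>\<sigma> | \<sigma> permutes I. \<Prod>i\<in>I. A i (\<sigma> i))"

definition adjacency_matrix :: "('a,'b) pre_digraph \<Rightarrow> 'a \<Rightarrow> 'a \<Rightarrow> real" where
  "adjacency_matrix G u v = (if u \<rightarrow>\<^bsub>G\<^esub> v then 1 else 0)"

definition permanental_poly :: "('a,'b) pre_digraph \<Rightarrow> real poly" where
  "permanental_poly G =
     permanent (verts G) (\<lambda>u v. (if u = v then [:0, 1:] else 0) - [:adjacency_matrix G u v:])"

text \<open>The permanental polynomial is monic, so \<^const>\<open>order\<close> is applied to a nonzero polynomial.\<close>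

definition per_nullity :: "('a,'b) pre_digraph \<Rightarrow> nat" where
  "per_nullity G = order 0 (permanental_poly G)"

end

theory Submission
  imports Defs "HOL-Combinatorics.Cycles"
begin

text \<open>
  The permanental polynomial \<^term>\<open>permanental_poly G\<close> is a sum over the permutations of the vertices.
  A permutation contributes only if it sends every vertex that it moves to a neighbour, and if it
  moves \<open>m\<close> vertices, its contribution is \<open>(-1)\<^sup>m x\<^sup>n\<^sup>-\<^sup>m\<close>. The sign depends on the degree only, so
  nothing cancels (for the determinant it could), and the multiplicity of the root \<open>0\<close> is
  \<open>n\<close> minus the largest number of vertices that such a permutation moves
  (\<open>per_nullity_eq_max_moved\<close>).

  For a unicyclic graph this largest number is the maximum of \<open>2 \<nu>(G)\<close> and \<open>l + 2 \<nu>(G - C)\<close>.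
  Both values are attained: exchange the ends of the edges of a maximum matching of \<open>G\<close>, or rotate
  the cycle and exchange the ends of the edges of a maximum matching of \<open>G - C\<close>. For the upper
  bound (\<open>matching_bounds_adjacency_perm\<close>), recall that removing an edge of the cycle leaves a
  tree, which is bipartite, and that in a bipartite graph the moved vertices of one colour,
  joined to their images, form a matching that covers all moved vertices.
  If a permutation does not use some edge of the cycle, it lives in such a tree, and it moves
  at most \<open>2 \<nu>(G)\<close> vertices. If it uses all \<open>l\<close> edges of the cycle, then counting shows that it maps
  the \<open>l\<close> vertices of the cycle among themselves, so that it permutes the vertices of the bipartite
  graph \<open>G - C\<close>, of which it moves at most \<open>2 \<nu>(G - C)\<close>.

  A matching of \<open>G - C\<close> extends by every second edge of the cycle, hence
  \<open>\<lfloor>l / 2\<rfloor> + \<nu>(G - C) \<le> \<nu>(G)\<close>. So \<open>l + 2 \<nu>(G - C)\<close> exceeds \<open>2 \<nu>(G)\<close> exactly when \<open>l\<close> is odd and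
  this inequality is an equality, and then it exceeds it by one.
\<close>

section \<open>Permutations along the arcs of a relation\<close>

abbreviation moved :: "('a \<Rightarrow> 'a) \<Rightarrow> 'a set" where
  "moved \<sigma> \<equiv> {v. \<sigma> v \<noteq> v}"

definition adjacency_perm :: "('a \<times> 'a) set \<Rightarrow> ('a \<Rightarrow> 'a) \<Rightarrow> bool" where
  "adjacency_perm R \<sigma> \<longleftrightarrow> bij \<sigma> \<and> (\<forall>v. \<sigma> v \<noteq> v \<longrightarrow> (v, \<sigma> v) \<in> R)"

text \<open>
  Subgraphs are handled as sets of arcs, for which this is the counterpart of \<^const>\<open>edges\<close>.
\<close>
definition undirected :: "('a \<times> 'a) set \<Rightarrow> 'a set set" where
  "undirected R = {{u, v} | u v. (u, v) \<in> R}"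

lemma finite_undirected: "finite R \<Longrightarrow> finite (undirected R)"
proof -
  assume "finite R"
  moreover have "undirected R = (\<lambda>(u, v). {u, v}) ` R"
    by (auto simp: undirected_def image_iff)
  ultimately show ?thesis by simp
qed

lemma undirectedI: "(u, v) \<in> R \<Longrightarrow> {u, v} \<in> undirected R"
  unfolding undirected_def by blast

lemma undirected_mono: "R \<subseteq> S \<Longrightarrow> undirected R \<subseteq> undirected S"
  by (auto simp: undirected_def)

lemma adjacency_perm_permutes:
  assumes "adjacency_perm R \<sigma>" "R \<subseteq> V \<times> V"
  shows "\<sigma> permutes V"
  using assms by (auto simp: adjacency_perm_def permutes_def bij_iff)

lemma moved_subset:
  assumes "adjacency_perm R \<sigma>" "R \<subseteq> V \<times> V"
  shows "moved \<sigma> \<subseteq> V"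
  using assms by (auto simp: adjacency_perm_def)

lemma image_moved: "bij \<sigma> \<Longrightarrow> \<sigma> ` moved \<sigma> = moved \<sigma>"
  by (auto simp: bij_def inj_def image_iff surj_def) metis

text \<open>
  Permutations that move disjoint sets of vertices can be combined. This builds the involution of a
  matching from its edges, and later joins the rotation of the cycle to such an involution.
\<close>
lemma adjacency_perm_comp:
  assumes \<sigma>: "adjacency_perm R \<sigma>" and \<tau>: "adjacency_perm R \<tau>"
    and disj: "moved \<sigma> \<inter> moved \<tau> = {}"
  shows "adjacency_perm R (\<sigma> \<circ> \<tau>)" and "moved (\<sigma> \<circ> \<tau>) = moved \<sigma> \<union> moved \<tau>"
proof -
  have on_\<tau>: "(\<sigma> \<circ> \<tau>) v = \<tau> v" if "v \<in> moved \<tau>" for v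
  proof -
    have "\<tau> v \<in> moved \<tau>"
      using image_moved[of \<tau>] that \<tau> unfolding adjacency_perm_def by blast
    then have "\<tau> v \<notin> moved \<sigma>" using disj by blast
    then show ?thesis by simp
  qed
  have off_\<tau>: "(\<sigma> \<circ> \<tau>) v = \<sigma> v" if "v \<notin> moved \<tau>" for v
    using that by simp
  show "moved (\<sigma> \<circ> \<tau>) = moved \<sigma> \<union> moved \<tau>"
  proof (rule set_eqI)
    fix v
    show "v \<in> moved (\<sigma> \<circ> \<tau>) \<longleftrightarrow> v \<in> moved \<sigma> \<union> moved \<tau>"
      using on_\<tau>[of v] off_\<tau>[of v] by (cases "v \<in> moved \<tau>") simp_all
  qed
  show "adjacency_perm R (\<sigma> \<circ> \<tau>)"
    unfolding adjacency_perm_def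
  proof (intro conjI allI impI)
    show "bij (\<sigma> \<circ> \<tau>)" using \<sigma> \<tau> by (auto simp: adjacency_perm_def intro: bij_comp)
    fix v assume "(\<sigma> \<circ> \<tau>) v \<noteq> v"
    then show "(v, (\<sigma> \<circ> \<tau>) v) \<in> R"
      using on_\<tau>[of v] off_\<tau>[of v] \<sigma> \<tau> unfolding adjacency_perm_def by (cases "v \<in> moved \<tau>") auto
  qed
qed

lemma adjacency_perm_of_matching:
  assumes "finite M" "sym R" "irrefl R" "M \<subseteq> undirected R" "pairwise disjnt M"
  shows "\<exists>\<sigma>. adjacency_perm R \<sigma> \<and> moved \<sigma> = \<Union>M \<and> card (moved \<sigma>) = 2 * card M"
  using assms(1,4,5)
proof (induction M)
  case empty
  show ?case by (intro exI[of _ "\<lambda>v. v"]) (simp add: adjacency_perm_def bij_id[unfolded id_def])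
next
  case (insert e M)
  then obtain \<tau> where \<tau>: "adjacency_perm R \<tau>" "moved \<tau> = \<Union>M" "card (moved \<tau>) = 2 * card M"
    by (auto simp: pairwise_insert)
  from insert.prems obtain u v where e: "e = {u, v}" and uv: "(u, v) \<in> R"
    by (auto simp: undirected_def)
  have "u \<noteq> v" using uv \<open>irrefl R\<close> by (auto simp: irrefl_def)
  define \<sigma> where "\<sigma> = transpose u v"
  have mv: "moved \<sigma> = e"
    using \<open>u \<noteq> v\<close> by (auto simp: \<sigma>_def e transpose_def)
  have adj: "adjacency_perm R \<sigma>"
    using uv \<open>sym R\<close> by (auto simp: adjacency_perm_def \<sigma>_def transpose_def sym_def)
  have disj: "moved \<sigma> \<inter> moved \<tau> = {}"
    using insert unfolding mv \<tau>(2) by (auto simp: pairwise_insert disjnt_def)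
  have fin: "finite (\<Union>M)"
    using insert.hyps insert.prems by (auto simp: undirected_def)
  have "card (e \<union> \<Union>M) = card e + card (\<Union>M)"
    using disj fin e mv \<tau>(2) by (intro card_Un_disjoint) auto
  then have "card (moved (\<sigma> \<circ> \<tau>)) = 2 * card (insert e M)"
    using adjacency_perm_comp(2)[OF adj \<tau>(1) disj] insert.hyps \<tau>(2,3) mv e \<open>u \<noteq> v\<close> by simp
  moreover have "moved (\<sigma> \<circ> \<tau>) = \<Union>(insert e M)"
    unfolding adjacency_perm_comp(2)[OF adj \<tau>(1) disj] mv \<tau>(2) by blast
  ultimately show ?case
    using adjacency_perm_comp(1)[OF adj \<tau>(1) disj] by blast
qed

text \<open>
  The permutation maps the moved vertices of each colour injectively to those of the other colour, so
  there are equally many of both. Joining each one of the first colour to its image uses no vertex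
  twice: images have the second colour and are distinct.
\<close>
lemma matching_of_bipartite_adjacency_perm:
  fixes col :: "'a \<Rightarrow> bool"
  assumes \<sigma>: "adjacency_perm R \<sigma>" and fin: "finite (moved \<sigma>)"
    and col: "\<And>u v. (u, v) \<in> R \<Longrightarrow> col u \<noteq> col v"
  shows "\<exists>M \<subseteq> undirected R. pairwise disjnt M \<and> card (moved \<sigma>) = 2 * card M"
proof -
  define A where "A = {v \<in> moved \<sigma>. col v}"
  define B where "B = {v \<in> moved \<sigma>. \<not> col v}"
  have inj: "inj \<sigma>" using \<sigma> by (auto simp: adjacency_perm_def bij_def)
  have mvI: "\<sigma> v \<in> moved \<sigma>" if "v \<in> moved \<sigma>" for v
    using image_moved[of \<sigma>] \<sigma> that by (auto simp: adjacency_perm_def)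
  have swap: "col (\<sigma> v) \<noteq> col v" if "v \<in> moved \<sigma>" for v
    using \<sigma> col[of v "\<sigma> v"] that by (auto simp: adjacency_perm_def)
  have "\<sigma> ` A \<subseteq> B" "\<sigma> ` B \<subseteq> A"
    using mvI swap by (auto simp: A_def B_def)
  moreover have finAB: "finite A" "finite B"
    using fin by (auto simp: A_def B_def)
  ultimately have "card A \<le> card B" "card B \<le> card A"
    using inj by (auto intro!: card_inj_on_le[where f = \<sigma>] intro: inj_on_subset)
  moreover have "card (moved \<sigma>) = card A + card B"
    using finAB by (subst card_Un_disjoint[symmetric]) (auto simp: A_def B_def intro: arg_cong[of _ _ card])
  ultimately have cardA: "card (moved \<sigma>) = 2 * card A" by simp
  define M where "M = (\<lambda>v. {v, \<sigma> v}) ` A"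
  have key: "v = w" if "v \<in> A" "w \<in> A" "{v, \<sigma> v} \<inter> {w, \<sigma> w} \<noteq> {}" for v w
  proof -
    have "\<sigma> v \<notin> A" "\<sigma> w \<notin> A"
      using that(1,2) swap[of v] swap[of w] by (simp_all add: A_def)
    then have "v \<noteq> \<sigma> w" "w \<noteq> \<sigma> v" using that(1,2) by metis+
    then show ?thesis using that(3) injD[OF inj, of v w] by auto
  qed
  have "inj_on (\<lambda>v. {v, \<sigma> v}) A"
  proof (rule inj_onI)
    fix v w assume "v \<in> A" "w \<in> A" "{v, \<sigma> v} = {w, \<sigma> w}"
    then show "v = w" using key[of v w] by simp
  qed
  then have "card M = card A" unfolding M_def by (rule card_image)
  moreover have "M \<subseteq> undirected R"
    using \<sigma> by (auto simp: M_def A_def adjacency_perm_def intro: undirectedI)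
  moreover have "pairwise disjnt M"
  proof (rule pairwiseI)
    fix e1 e2 assume "e1 \<in> M" "e2 \<in> M" "e1 \<noteq> e2"
    moreover from this obtain v w where "v \<in> A" "w \<in> A" "e1 = {v, \<sigma> v}" "e2 = {w, \<sigma> w}"
      by (auto simp: M_def)
    ultimately show "disjnt e1 e2"
      using key[of v w] by (cases "disjnt e1 e2") (auto simp: disjnt_def)
  qed
  ultimately show ?thesis using cardA by auto
qed

section \<open>The permanental nullity\<close>

text \<open>
  A fixed vertex contributes the variable, because the graph has no loops; a vertex moved along
  an arc contributes \<open>-1\<close>; one moved elsewhere makes the product vanish.
\<close>
lemma prod_characteristic_entries:
  fixes G :: "('a, 'b) pre_digraph"
  assumes G: "graph G" and \<sigma>: "\<sigma> permutes verts G"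
  shows "(\<Prod>v\<in>verts G. (if v = \<sigma> v then [:0, 1:] else 0) - [:adjacency_matrix G v (\<sigma> v):])
    = (if adjacency_perm (arcs_ends G) \<sigma>
       then monom ((-1) ^ card (moved \<sigma>)) (card (verts G) - card (moved \<sigma>)) else 0)"
    (is "prod ?f _ = _")
proof -
  interpret graph G by (fact G)
  have bij: "bij \<sigma>" using \<sigma> by (rule permutes_bij)
  have sub: "moved \<sigma> \<subseteq> verts G" using \<sigma> by (auto simp: permutes_def)
  show ?thesis
  proof (cases "adjacency_perm (arcs_ends G) \<sigma>")
    case True
    have "?f v = (if v \<in> moved \<sigma> then [:-1:] else monom 1 1)" for v
    proof (cases "v \<in> moved \<sigma>")
      case mv: True
      then have "v \<rightarrow>\<^bsub>G\<^esub> \<sigma> v" using True by (auto simp: adjacency_perm_def)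
      then show ?thesis using mv by (auto simp: adjacency_matrix_def)
    next
      case False
      then show ?thesis using adj_not_same
        by (auto simp: adjacency_matrix_def monom_Suc)
    qed
    then have "prod ?f (verts G) = (\<Prod>v\<in>verts G. if v \<in> moved \<sigma> then [:-1:] else monom 1 1)"
      by simp
    also have "\<dots> = [:-1:] ^ card (verts G \<inter> moved \<sigma>) * monom 1 1 ^ card (verts G \<inter> - moved \<sigma>)"
      using finite_verts by (simp add: prod.If_cases Compl_eq)
    also have "verts G \<inter> moved \<sigma> = moved \<sigma>" using sub by blast
    also have "card (verts G \<inter> - moved \<sigma>) = card (verts G) - card (moved \<sigma>)"
      using sub finite_subset[OF sub finite_verts] by (simp add: Diff_eq[symmetric] card_Diff_subset)
    also have "[:-1::real:] ^ card (moved \<sigma>) = [:(-1) ^ card (moved \<sigma>):]"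
      by (simp add: poly_const_pow)
    finally show ?thesis using True
      by (simp add: monom_power smult_monom)
  next
    case False
    then obtain v where v: "\<sigma> v \<noteq> v" "\<not> v \<rightarrow>\<^bsub>G\<^esub> \<sigma> v"
      using bij by (auto simp: adjacency_perm_def)
    then have v0: "?f v = 0" "v \<in> verts G"
      using sub by (auto simp: adjacency_matrix_def)
    have "prod ?f (verts G) = 0" using finite_verts by (rule prod_zero) (use v0 in blast)
    then show ?thesis using False by simp
  qed
qed

text \<open>
  All permutations contributing to the power \<open>x\<^sup>k\<close> move \<open>n - k\<close> vertices and so contribute with the
  same sign. Hence the coefficient is, up to sign, the number of these permutations.
\<close>
lemma per_nullity_eq_max_moved:
  fixes G :: "('a, 'b) pre_digraph"
  assumes G: "graph G" and \<sigma>: "adjacency_perm (arcs_ends G) \<sigma>"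
    and max: "\<And>\<tau>. adjacency_perm (arcs_ends G) \<tau> \<Longrightarrow> card (moved \<tau>) \<le> card (moved \<sigma>)"
  shows "per_nullity G = card (verts G) - card (moved \<sigma>)"
proof -
  interpret graph G by (fact G)
  define n where "n = card (verts G)"
  define P where "P = {\<tau>. adjacency_perm (arcs_ends G) \<tau>}"
  have arcs: "arcs_ends G \<subseteq> verts G \<times> verts G" using adj_in_verts by auto
  have perm: "\<tau> permutes verts G" if "\<tau> \<in> P" for \<tau>
    using that adjacency_perm_permutes[OF _ arcs] by (auto simp: P_def)
  have le: "card (moved \<tau>) \<le> n" if "\<tau> \<in> P" for \<tau>
    using that moved_subset[OF _ arcs, of \<tau>] finite_verts by (auto simp: P_def n_def intro: card_mono)
  have fin: "finite {\<tau>. \<tau> permutes verts G}" using finite_verts by (rule finite_permutations)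
  then have finP: "finite P" using perm by (auto elim: finite_subset[rotated])
  have "permanental_poly G
      = (\<Sum>\<tau> | \<tau> permutes verts G. if \<tau> \<in> P then monom ((-1) ^ card (moved \<tau>)) (n - card (moved \<tau>)) else 0)"
    unfolding permanental_poly_def permanent_def
    by (intro sum.cong refl) (simp add: prod_characteristic_entries[OF G] P_def n_def)
  also have "\<dots> = (\<Sum>\<tau>\<in>P. monom ((-1) ^ card (moved \<tau>)) (n - card (moved \<tau>)))"
    using perm by (intro sum.mono_neutral_cong_right) (auto simp: fin)
  finally have poly: "permanental_poly G = (\<Sum>\<tau>\<in>P. monom ((-1) ^ card (moved \<tau>)) (n - card (moved \<tau>)))" .
  have coeff: "coeff (permanental_poly G) k = (-1) ^ (n - k) * real (card {\<tau> \<in> P. n - card (moved \<tau>) = k})" for k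
  proof -
    have "coeff (permanental_poly G) k
        = (\<Sum>\<tau>\<in>P. if n - card (moved \<tau>) = k then (-1) ^ card (moved \<tau>) else 0)"
      by (simp add: poly coeff_sum coeff_monom)
    also have "\<dots> = (\<Sum>\<tau>\<in>P. if n - card (moved \<tau>) = k then (-1) ^ (n - k) else 0)"
      using le by (intro sum.cong refl) auto
    also have "\<dots> = (-1) ^ (n - k) * real (card {\<tau> \<in> P. n - card (moved \<tau>) = k})"
      using finP by (simp add: sum.inter_filter[symmetric])
    finally show ?thesis .
  qed
  define m where "m = n - card (moved \<sigma>)"
  have "\<sigma> \<in> P" using \<sigma> by (simp add: P_def)
  then have "{\<tau> \<in> P. n - card (moved \<tau>) = m} \<noteq> {}" by (auto simp: m_def)
  then have nz: "coeff (permanental_poly G) m \<noteq> 0" using finP by (simp add: coeff card_eq_0_iff)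
  then have nz': "permanental_poly G \<noteq> 0" by auto
  have low: "coeff (permanental_poly G) k = 0" if "k < m" for k
  proof -
    have "n - card (moved \<tau>) \<noteq> k" if "\<tau> \<in> P" for \<tau>
      using max[of \<tau>] that \<open>k < m\<close> by (auto simp: P_def m_def)
    then have none: "{\<tau> \<in> P. n - card (moved \<tau>) = k} = {}" by blast
    show ?thesis unfolding coeff none by simp
  qed
  have "k \<le> per_nullity G \<longleftrightarrow> k \<le> m" for k
    unfolding per_nullity_def monom_1_dvd_iff[OF nz', symmetric] monom_1_dvd_iff'
    using low nz by (meson leI less_le_trans)
  then show ?thesis by (metis le_antisym le_refl m_def n_def)
qed

section \<open>Trees are bipartite\<close>

text \<open>
  Breadth-first search from \<open>r\<close> yields, for every other vertex, an edge to a parent one level closer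
  to \<open>r\<close>. These \<open>card V - 1\<close> edges are distinct, so under the assumption on the number of edges there
  are no others: every edge joins consecutive levels, and the parity of the level is a colouring.
\<close>
lemma bipartite_if_few_edges:
  assumes fin: "finite V" and R: "R \<subseteq> V \<times> V" and r: "r \<in> V"
    and reach: "\<And>v. v \<in> V \<Longrightarrow> (r, v) \<in> R\<^sup>*"
    and few: "card (undirected R) < card V"
  shows "\<exists>col :: 'a \<Rightarrow> bool. \<forall>(u, v)\<in>R. col u \<noteq> col v"
proof -
  define d where "d v = (LEAST k. (r, v) \<in> R ^^ k)" for v
  have d: "(r, v) \<in> R ^^ d v" if "v \<in> V" for v
    using reach[OF that] unfolding d_def by (auto simp: rtrancl_power intro: LeastI)
  have d_le: "d v \<le> k" if "(r, v) \<in> R ^^ k" for v k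
    using that unfolding d_def by (rule Least_le)
  have "\<exists>p. (p, v) \<in> R \<and> d v = Suc (d p)" if v: "v \<in> V - {r}" for v
  proof -
    have "d v \<noteq> 0" using d[of v] v by (cases "d v") auto
    then obtain k where k: "d v = Suc k" by (cases "d v") auto
    then obtain p where p: "(r, p) \<in> R ^^ k" "(p, v) \<in> R" using d[of v] v by auto
    have "p \<in> V" using p(2) R by auto
    have "(r, v) \<in> R ^^ Suc (d p)" using d[OF \<open>p \<in> V\<close>] p(2) by auto
    then have "Suc k \<le> Suc (d p)" using d_le k by metis
    moreover have "d p \<le> k" using d_le p(1) .
    ultimately show ?thesis using p k by auto
  qed
  then obtain p where p: "\<And>v. v \<in> V - {r} \<Longrightarrow> (p v, v) \<in> R \<and> d v = Suc (d (p v))"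
    by metis
  define e where "e v = {p v, v}" for v
  have "inj_on e (V - {r})"
  proof (rule inj_onI)
    fix v w assume v: "v \<in> V - {r}" and w: "w \<in> V - {r}" and "e v = e w"
    then have "v = w \<or> (p v = w \<and> p w = v)" by (auto simp: e_def doubleton_eq_iff)
    moreover have "\<not> (p v = w \<and> p w = v)" using p[OF v] p[OF w] by auto
    ultimately show "v = w" by blast
  qed
  then have "card (e ` (V - {r})) = card V - 1" using r fin by (simp add: card_image)
  moreover have finR: "finite (undirected R)"
    using finite_subset[OF R] fin by (intro finite_undirected) auto
  moreover have "e ` (V - {r}) \<subseteq> undirected R" using p by (auto simp: e_def intro: undirectedI)
  ultimately have all: "e ` (V - {r}) = undirected R"
    using few by (intro card_seteq) auto
  have "even (d u) \<noteq> even (d v)" if "(u, v) \<in> R" for u v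
  proof -
    have "{u, v} \<in> e ` (V - {r})" unfolding all using that by (rule undirectedI)
    then obtain w where "w \<in> V - {r}" "{u, v} = {p w, w}" by (auto simp: e_def)
    then show ?thesis using p[of w] by (auto simp: doubleton_eq_iff)
  qed
  then show ?thesis by (intro exI[of _ "\<lambda>v. even (d v)"]) auto
qed

section \<open>Cycles\<close>

text \<open>
  A list of vertices allows access to the positions on the cycle modulo its length. The bound
  excludes the walk back and forth along one edge.
\<close>
definition vertex_cycle :: "('a \<times> 'a) set \<Rightarrow> 'a list \<Rightarrow> bool" where
  "vertex_cycle R vs \<longleftrightarrow> distinct vs \<and> 3 \<le> length vs \<and>
     (\<forall>i < length vs. (vs ! i, vs ! (Suc i mod length vs)) \<in> R)"

locale cycle_in_graph =
  fixes V :: "'a set" and R :: "('a \<times> 'a) set" and vs :: "'a list"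
  assumes finite_V: "finite V" and R_subset: "R \<subseteq> V \<times> V" and sym_R: "sym R" and irrefl_R: "irrefl R"
    and cyc: "vertex_cycle R vs"
begin

abbreviation l :: nat where "l \<equiv> length vs"

definition c :: "nat \<Rightarrow> 'a" where "c k = vs ! (k mod l)"

lemma l_ge_3: "3 \<le> l" and distinct_vs: "distinct vs"
  using cyc by (auto simp: vertex_cycle_def)

lemma mod_l_less: "k mod l < l"
  using l_ge_3 by (intro mod_less_divisor) linarith

lemma c_eq_iff: "c i = c j \<longleftrightarrow> i mod l = j mod l"
  unfolding c_def by (rule nth_eq_iff_index_eq[OF distinct_vs mod_l_less mod_l_less])

lemma c_arc: "(c k, c (Suc k)) \<in> R" "(c (Suc k), c k) \<in> R"
proof -
  have "(vs ! (k mod l), vs ! (Suc (k mod l) mod l)) \<in> R"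
    using cyc mod_l_less by (simp add: vertex_cycle_def)
  then show "(c k, c (Suc k)) \<in> R" by (simp add: c_def mod_Suc_eq)
  then show "(c (Suc k), c k) \<in> R" using sym_R by (auto dest: symD)
qed

lemma c_in_cycle: "c k \<in> set vs"
  unfolding c_def using mod_l_less by (rule nth_mem)

lemma image_c: "c ` {..<l} = set vs"
proof
  show "c ` {..<l} \<subseteq> set vs" using c_in_cycle by blast
  show "set vs \<subseteq> c ` {..<l}"
  proof
    fix v assume "v \<in> set vs"
    then obtain k where "k < l" "v = vs ! k" by (auto simp: in_set_conv_nth)
    then show "v \<in> c ` {..<l}" by (intro image_eqI[of _ _ k]) (simp_all add: c_def)
  qed
qed

lemma cycle_subset: "set vs \<subseteq> V"
proof
  fix v assume "v \<in> set vs"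
  then obtain k where "v = c k" using image_c by blast
  then show "v \<in> V" using c_arc(1)[of k] R_subset by blast
qed

lemma card_cycle: "card (set vs) = l"
  using distinct_vs by (rule distinct_card)

text \<open>
  Two edges of the cycle could coincide without having the same position only if they were
  traversed in opposite directions, which would force \<open>l\<close> to divide \<open>2\<close>.
\<close>
lemma cycle_edge_eq_iff: "{c i, c (Suc i)} = {c j, c (Suc j)} \<longleftrightarrow> i mod l = j mod l"
proof
  assume "{c i, c (Suc i)} = {c j, c (Suc j)}"
  then consider "c i = c j" | "c i = c (Suc j)" "c (Suc i) = c j"
    by (auto simp: doubleton_eq_iff)
  then show "i mod l = j mod l"
  proof cases
    case 2
    then have i: "i mod l = Suc j mod l" and "j mod l = Suc i mod l"
      by (simp_all add: c_eq_iff)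
    note this(2)
    also have "Suc i mod l = Suc (i mod l) mod l" by (rule mod_Suc_eq[symmetric])
    also have "\<dots> = Suc (Suc j mod l) mod l" by (simp only: i)
    also have "\<dots> = Suc (Suc j) mod l" by (rule mod_Suc_eq)
    finally have "j mod l = Suc (Suc j) mod l" .
    then have "l dvd Suc (Suc j) - j" using mod_eq_dvd_iff_nat[of j "Suc (Suc j)" l] by simp
    then have "l dvd 2" by simp
    then show ?thesis using l_ge_3 by (auto dest: dvd_imp_le)
  qed (simp add: c_eq_iff)
next
  assume "i mod l = j mod l"
  moreover from this have "Suc i mod l = Suc j mod l" by (metis mod_Suc_eq)
  ultimately have "c i = c j" "c (Suc i) = c (Suc j)" by (simp_all add: c_eq_iff)
  then show "{c i, c (Suc i)} = {c j, c (Suc j)}" by simp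
qed

definition without_edge :: "nat \<Rightarrow> ('a \<times> 'a) set" where
  "without_edge i = R - {(c i, c (Suc i)), (c (Suc i), c i)}"

lemma sym_without_edge: "sym (without_edge i)"
  using sym_R by (auto simp: without_edge_def sym_def)

lemma without_edge_iff: "(u, v) \<in> without_edge i \<longleftrightarrow> (u, v) \<in> R \<and> {u, v} \<noteq> {c i, c (Suc i)}"
  by (auto simp: without_edge_def doubleton_eq_iff)

text \<open>
  A cycle edge is never needed for connectivity, because the rest of the cycle joins its ends.
\<close>
lemma rtrancl_without_edge: "(without_edge i)\<^sup>* = R\<^sup>*"
proof -
  have path: "j < l \<Longrightarrow> (c (Suc i), c (Suc i + j)) \<in> (without_edge i)\<^sup>*" for j
  proof (induction j)
    case (Suc j)
    have "Suc (i + j) mod l \<noteq> i mod l"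
    proof
      assume "Suc (i + j) mod l = i mod l"
      then have "l dvd Suc (i + j) - i" using mod_eq_dvd_iff_nat[of i "Suc (i + j)" l] by simp
      then show False using Suc.prems by (auto dest: dvd_imp_le)
    qed
    then have "(c (Suc i + j), c (Suc i + Suc j)) \<in> without_edge i"
      using c_arc(1)[of "Suc (i + j)"] cycle_edge_eq_iff[of "Suc (i + j)" i] by (simp add: without_edge_iff)
    then show ?case using Suc by (auto intro: rtrancl_into_rtrancl)
  qed simp
  have around: "Suc i + (l - 1) = i + l" using l_ge_3 by simp
  have "c (Suc i + (l - 1)) = c i" unfolding around c_eq_iff by simp
  then have "(c (Suc i), c i) \<in> (without_edge i)\<^sup>*"
    using path[of "l - 1"] l_ge_3 by simp
  moreover from this have "(c i, c (Suc i)) \<in> (without_edge i)\<^sup>*"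
    using sym_rtrancl[OF sym_without_edge] by (auto dest: symD)
  ultimately have "R \<subseteq> (without_edge i)\<^sup>*" by (auto simp: without_edge_def)
  moreover have "without_edge i \<subseteq> R" by (auto simp: without_edge_def)
  ultimately show ?thesis by (metis rtrancl_subset)
qed

text \<open>
  A connected graph with as many edges as vertices becomes a tree when a cycle edge is removed.
\<close>
lemma bipartite_without_edge:
  assumes conn: "V \<times> V \<subseteq> R\<^sup>*"
    and card: "card (undirected R) = card V"
  shows "\<exists>col :: 'a \<Rightarrow> bool. \<forall>(u, v)\<in>without_edge i. col u \<noteq> col v"
proof (rule bipartite_if_few_edges[OF finite_V])
  show "without_edge i \<subseteq> V \<times> V" using R_subset by (auto simp: without_edge_def)
  have c0: "c 0 \<in> V" using c_in_cycle cycle_subset by auto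
  then show "c 0 \<in> V" .
  show "(c 0, v) \<in> (without_edge i)\<^sup>*" if "v \<in> V" for v
    using conn c0 that by (auto simp: rtrancl_without_edge)
  have "{c i, c (Suc i)} \<in> undirected R" using c_arc(1) by (rule undirectedI)
  moreover have "{c i, c (Suc i)} \<notin> undirected (without_edge i)"
    by (auto simp: undirected_def without_edge_iff)
  moreover have "undirected (without_edge i) \<subseteq> undirected R"
    by (rule undirected_mono) (auto simp: without_edge_def)
  ultimately have "undirected (without_edge i) \<subset> undirected R" by blast
  moreover have "finite (undirected R)"
    using finite_subset[OF R_subset] finite_V by (intro finite_undirected) auto
  ultimately show "card (undirected (without_edge i)) < card V"
    unfolding card[symmetric] by (rule psubset_card_mono[rotated])
qed

lemma cycle_rotation: 
  "adjacency_perm R (cycle_of_list vs)" "moved (cycle_of_list vs) = set vs"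
proof -
  have img: "cycle_of_list vs (c k) = c (Suc k)" for k
  proof -
    have "map (cycle_of_list vs) vs = rotate1 vs"
      using cyclic_rotation[OF distinct_vs, of 1] by simp
    then have "cycle_of_list vs (vs ! (k mod l)) = rotate1 vs ! (k mod l)"
      using nth_map[OF mod_l_less, of "cycle_of_list vs" k] by simp
    also have "\<dots> = c (Suc k)" using mod_l_less by (simp add: nth_rotate1 c_def mod_Suc_eq)
    finally show ?thesis by (simp add: c_def)
  qed
  have ne: "c (Suc k) \<noteq> c k" for k
    using c_arc(1)[of k] irrefl_R by (auto simp: irrefl_def)
  have in_c: "v \<in> set vs \<Longrightarrow> \<exists>k. v = c k" for v using image_c by blast
  have out: "v \<notin> set vs \<Longrightarrow> cycle_of_list vs v = v" for v by (rule id_outside_supp)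
  show "moved (cycle_of_list vs) = set vs"
    using img ne in_c out by (auto, metis)
  show "adjacency_perm R (cycle_of_list vs)"
    unfolding adjacency_perm_def
    using permutes_bij[OF cycle_permutes] img c_arc(1) in_c out by metis
qed

lemma cycle_matching:
  "\<exists>M \<subseteq> undirected R. pairwise disjnt M \<and> card M = l div 2 \<and> \<Union>M \<subseteq> set vs"
proof -
  define e where "e k = {c (2 * k), c (Suc (2 * k))}" for k
  define M where "M = e ` {..<l div 2}"
  have key: "i = j" if "i < l div 2" "j < l div 2" "e i \<inter> e j \<noteq> {}" for i j
  proof -
    have "2 * i < l" "Suc (2 * i) < l" "2 * j < l" "Suc (2 * j) < l" using that by auto
    then show ?thesis using that(3) by (auto simp: e_def c_eq_iff)
  qed
  have "inj_on e {..<l div 2}"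
  proof (rule inj_onI)
    fix i j assume "i \<in> {..<l div 2}" "j \<in> {..<l div 2}" "e i = e j"
    then show "i = j" using key[of i j] by (simp add: e_def)
  qed
  then have "card M = l div 2" by (simp add: M_def card_image)
  moreover have "M \<subseteq> undirected R" using c_arc(1) by (auto simp: M_def e_def intro: undirectedI)
  moreover have "pairwise disjnt M"
  proof (rule pairwiseI)
    fix e1 e2 assume "e1 \<in> M" "e2 \<in> M" "e1 \<noteq> e2"
    moreover from this obtain i j where "i < l div 2" "j < l div 2" "e1 = e i" "e2 = e j"
      by (auto simp: M_def)
    ultimately show "disjnt e1 e2"
      using key[of i j] by (cases "disjnt e1 e2") (auto simp: disjnt_def)
  qed
  moreover have "\<Union>M \<subseteq> set vs" using c_in_cycle by (auto simp: M_def e_def)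
  ultimately show ?thesis by blast
qed

text \<open>
  Each of the \<open>l\<close> cycle edges is used by \<open>\<sigma>\<close> at one of its ends, a vertex of the cycle. A vertex
  \<open>v\<close> serves only the edge \<open>{v, \<sigma> v}\<close>, so the \<open>l\<close> edges are served by \<open>l\<close> different vertices.
  These are all the vertices of the cycle, and each of them is moved along a cycle edge.
\<close>
lemma cycle_invariant:
  assumes all: "\<And>i. i < l \<Longrightarrow> \<exists>v. {v, \<sigma> v} = {c i, c (Suc i)}"
    and v: "v \<in> set vs"
  shows "\<sigma> v \<in> set vs"
proof -
  obtain w where w: "\<And>i. i < l \<Longrightarrow> {w i, \<sigma> (w i)} = {c i, c (Suc i)}"
    using all by metis
  have "inj_on w {..<l}"
  proof (rule inj_onI)
    fix i j assume "i \<in> {..<l}" "j \<in> {..<l}" "w i = w j"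
    then show "i = j" using w[of i] w[of j] cycle_edge_eq_iff[of i j] by simp
  qed
  moreover have "w i \<in> set vs" if "i < l" for i
    using w[OF that] c_in_cycle[of i] c_in_cycle[of "Suc i"] by (auto simp: doubleton_eq_iff)
  then have "w ` {..<l} \<subseteq> set vs" by blast
  ultimately have "w ` {..<l} = set vs"
    using card_cycle by (intro card_seteq) (auto simp: card_image)
  then obtain i where "i < l" "v = w i" using v by auto
  then show ?thesis using w[of i] c_in_cycle[of i] c_in_cycle[of "Suc i"] by (auto simp: doubleton_eq_iff)
qed

text \<open>
  The two alternatives correspond to \<open>\<sigma>\<close> missing a cycle edge and to \<open>\<sigma>\<close> using all of them.
\<close>
lemma matching_bounds_adjacency_perm:
  assumes conn: "V \<times> V \<subseteq> R\<^sup>*"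
    and card: "card (undirected R) = card V"
    and \<sigma>: "adjacency_perm R \<sigma>"
  shows "(\<exists>M \<subseteq> undirected R. pairwise disjnt M \<and> card (moved \<sigma>) \<le> 2 * card M) \<or>
    (\<exists>M \<subseteq> undirected (R \<inter> (V - set vs) \<times> (V - set vs)).
       pairwise disjnt M \<and> card (moved \<sigma>) \<le> l + 2 * card M)"
proof (cases "\<exists>i<l. \<forall>v. {v, \<sigma> v} \<noteq> {c i, c (Suc i)}")
  case True
  then obtain i where i: "\<And>v. {v, \<sigma> v} \<noteq> {c i, c (Suc i)}" by blast
  obtain col :: "'a \<Rightarrow> bool" where col: "\<And>u v. (u, v) \<in> without_edge i \<Longrightarrow> col u \<noteq> col v"
    using bipartite_without_edge[OF conn card, of i] by blast
  have "adjacency_perm (without_edge i) \<sigma>"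
    using \<sigma> i by (auto simp: adjacency_perm_def without_edge_iff)
  moreover have "finite (moved \<sigma>)"
    using moved_subset[OF \<sigma> R_subset] finite_V by (rule finite_subset)
  ultimately obtain M where "M \<subseteq> undirected (without_edge i)" "pairwise disjnt M" "card (moved \<sigma>) = 2 * card M"
    using matching_of_bipartite_adjacency_perm[of "without_edge i" \<sigma> col] col by blast
  moreover have "undirected (without_edge i) \<subseteq> undirected R"
    by (rule undirected_mono) (auto simp: without_edge_def)
  ultimately show ?thesis by (metis order_refl order_trans)
next
  case False
  let ?S = "R \<inter> (V - set vs) \<times> (V - set vs)"
  have bij: "bij \<sigma>" using \<sigma> by (simp add: adjacency_perm_def)
  have inv: "\<sigma> v \<in> set vs" if "v \<in> set vs" for v
    using cycle_invariant[OF _ that] False by blast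
  have img: "\<sigma> ` set vs = set vs"
    using inv inj_on_subset[OF bij_is_inj[OF bij]] by (intro endo_inj_surj) auto
  have inv': "\<sigma> v \<in> set vs \<longleftrightarrow> v \<in> set vs" for v
    using img bij by (metis bij_is_inj inj_image_mem_iff)
  define \<tau> where "\<tau> v = (if v \<in> set vs then v else \<sigma> v)" for v
  have "bij \<tau>"
  proof (rule bijI)
    show "inj \<tau>"
    proof (rule injI)
      fix u v assume "\<tau> u = \<tau> v"
      then show "u = v"
        using inv'[of u] inv'[of v] injD[OF bij_is_inj[OF bij], of u v]
        by (auto simp: \<tau>_def split: if_splits)
    qed
    show "surj \<tau>"
    proof (rule surjI)
      fix v
      show "\<tau> (if v \<in> set vs then v else inv \<sigma> v) = v"
        using inv'[of "inv \<sigma> v"] surj_f_inv_f[OF bij_is_surj[OF bij], of v] by (simp add: \<tau>_def)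
    qed
  qed
  moreover have "(v, \<tau> v) \<in> ?S" if "\<tau> v \<noteq> v" for v
  proof -
    have v: "v \<notin> set vs" "\<sigma> v \<noteq> v" using that by (auto simp: \<tau>_def split: if_splits)
    then have "(v, \<sigma> v) \<in> R" using \<sigma> by (simp add: adjacency_perm_def)
    then show ?thesis using v R_subset inv' by (auto simp: \<tau>_def)
  qed
  ultimately have \<tau>: "adjacency_perm ?S \<tau>" by (simp add: adjacency_perm_def)
  \<comment> \<open>removing the cycle also removes its edge at position 0, so what remains lies in a tree\<close>
  obtain col :: "'a \<Rightarrow> bool" where col: "\<And>u v. (u, v) \<in> without_edge 0 \<Longrightarrow> col u \<noteq> col v"
    using bipartite_without_edge[OF conn card, of 0] by blast
  have S: "?S \<subseteq> without_edge 0"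
    using c_in_cycle[of 0] by (auto simp: without_edge_def)
  have col': "col u \<noteq> col v" if "(u, v) \<in> ?S" for u v
    by (rule col, rule subsetD[OF S that])
  have "moved \<tau> \<subseteq> V" using \<tau> by (auto simp: adjacency_perm_def)
  then have fin: "finite (moved \<tau>)" using finite_V by (rule finite_subset)
  obtain M where M: "M \<subseteq> undirected ?S" "pairwise disjnt M" "card (moved \<tau>) = 2 * card M"
    using matching_of_bipartite_adjacency_perm[where col = col, OF \<tau> fin col'] by auto
  have "moved \<sigma> \<subseteq> set vs \<union> moved \<tau>" by (auto simp: \<tau>_def)
  then have "card (moved \<sigma>) \<le> card (set vs \<union> moved \<tau>)" using fin by (intro card_mono) auto
  also have "\<dots> \<le> l + 2 * card M" using card_Un_le[of "set vs" "moved \<tau>"] M(3) card_cycle by simp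
  finally show ?thesis using M by blast
qed

end

section \<open>Matchings and cycles of a graph\<close>

lemma edges_eq_undirected: "edges G = undirected (arcs_ends G)"
  by (simp add: edges_def undirected_def)

lemma arcs_ends_del_verts:
  "arcs_ends (del_verts G S) = arcs_ends G \<inter> (verts G - S) \<times> (verts G - S)"
  unfolding del_verts_def arcs_ends_conv induce_subgraph_arcs induce_subgraph_tail induce_subgraph_head
  by blast

lemma finite_matchings: "finite (edges G) \<Longrightarrow> finite {M. matching G M}"
  by (rule finite_subset[where B = "Pow (edges G)"]) (auto simp: matching_def)

lemma maximum_matching_exists:
  assumes "finite (edges G)"
  shows "\<exists>M. matching G M \<and> card M = matching_number G"
proof -
  have "matching G {}" by (simp add: matching_def)
  then have "card ` {M. matching G M} \<noteq> {}" by blast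
  then have "matching_number G \<in> card ` {M. matching G M}"
    unfolding matching_number_def using finite_matchings[OF assms] by (intro Max_in) auto
  then show ?thesis by auto
qed

lemma card_le_matching_number:
  "finite (edges G) \<Longrightarrow> matching G M \<Longrightarrow> card M \<le> matching_number G"
  unfolding matching_number_def by (rule Max_ge) (auto simp: finite_matchings)

text \<open>
  For a closed walk this says that the list of heads is the list of tails rotated by one.
\<close>
lemma (in pre_digraph) tails_snoc_eq_Cons_heads:
  "cas u p v \<Longrightarrow> map (tail G) p @ [v] = u # map (head G) p"
  by (induction p arbitrary: u) auto

lemma vertex_cycle_of_cycle_graph:
  assumes sub: "subgraph C G" and "cycle_graph C"
  obtains vs where "vertex_cycle (arcs_ends G) vs" "set vs = verts C"
proof -
  obtain p where p: "pre_digraph.cycle C p" "3 \<le> length p" "verts C = tail C ` set p"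
    using assms(2) by (auto simp: cycle_graph_def)
  then obtain u where u: "pre_digraph.awalk C u p u" "distinct (tl (pre_digraph.awalk_verts C u p))"
    by (auto simp: pre_digraph.cycle_def)
  then have cas: "pre_digraph.cas C u p u" and arcs: "set p \<subseteq> arcs C"
    by (auto simp: pre_digraph.awalk_def)
  define vs where "vs = map (tail C) p"
  have "rotate1 vs = map (head C) p"
    using pre_digraph.tails_snoc_eq_Cons_heads[OF cas] p(2) by (cases p) (auto simp: vs_def)
  moreover have "distinct (map (head C) p)"
    using u(2) p(2) unfolding pre_digraph.awalk_verts_conv'[OF cas] by (auto split: if_splits)
  ultimately have rot: "rotate1 vs = map (head C) p" "distinct vs"
    using distinct1_rotate[of vs] by simp_all
  have "(vs ! i, vs ! (Suc i mod length vs)) \<in> arcs_ends G" if "i < length vs" for i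
  proof -
    have i: "i < length p" using that by (simp add: vs_def)
    have "vs ! (Suc i mod length vs) = head C (p ! i)"
      using nth_rotate1[OF that] rot(1) i by simp
    moreover have "vs ! i = tail C (p ! i)" using i by (simp add: vs_def)
    moreover have "p ! i \<in> arcs C" using arcs i by (auto simp: subset_iff)
    ultimately have "(vs ! i, vs ! (Suc i mod length vs)) \<in> arcs_ends C"
      by (auto simp: arcs_ends_conv)
    then show ?thesis using arcs_ends_mono[OF sub] by blast
  qed
  then have "vertex_cycle (arcs_ends G) vs"
    using rot(2) p(2) by (auto simp: vertex_cycle_def vs_def)
  then show ?thesis using that p(3) by (auto simp: vs_def)
qed

section \<open>The permanental nullity of a unicyclic graph\<close>

theorem theorem5p1:
  fixes G C :: "('a,'b) pre_digraph" and n l :: nat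
  assumes "unicyclic G" and "n = card (verts G)"
    and "subgraph C G" and "cycle_graph C" and "l = card (verts C)"
  shows "int (per_nullity G) =
    (if odd l \<and> matching_number G = (l - 1) div 2 + matching_number (del_verts G (verts C))
     then int n - 2 * int (matching_number G) - 1
     else int n - 2 * int (matching_number G))"
proof -
  from assms(1) have G: "graph G" and conn: "connected G" and card: "card (edges G) = card (verts G)"
    by (auto simp: unicyclic_def)
  interpret graph G by (fact G)
  obtain vs where vs: "vertex_cycle (arcs_ends G) vs" "set vs = verts C"
    using vertex_cycle_of_cycle_graph[OF assms(3,4)] .
  let ?R = "arcs_ends G" and ?H = "del_verts G (verts C)"
  have sym: "sym ?R" using sym_arcs by (simp add: symmetric_def)
  have irrefl: "irrefl ?R" using adj_not_same by (auto simp: irrefl_def)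
  have sub: "?R \<subseteq> verts G \<times> verts G" using adj_in_verts by auto
  interpret K: cycle_in_graph "verts G" ?R vs
    using finite_verts sub sym irrefl vs(1) by unfold_locales
  have l: "length vs = l" using K.card_cycle vs(2) assms(5) by simp
  have conn': "verts G \<times> verts G \<subseteq> ?R\<^sup>*"
    using conn reachable_mk_symmetric_eq[OF sym_arcs]
    by (auto simp: connected_def strongly_connected_def intro: reachable_rtranclI)
  have finR: "finite ?R" by (simp add: arcs_ends_def)
  have H: "edges ?H = undirected (?R \<inter> (verts G - set vs) \<times> (verts G - set vs))"
    by (simp add: edges_eq_undirected arcs_ends_del_verts vs(2))
  have HG: "edges ?H \<subseteq> edges G" unfolding H edges_eq_undirected[of G] by (rule undirected_mono) blast
  have finG: "finite (edges G)" using finR by (simp add: edges_eq_undirected finite_undirected)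
  have finH: "finite (edges ?H)" using HG finG by (rule finite_subset)
  note maxG = card_le_matching_number[OF finG] and maxH = card_le_matching_number[OF finH]
  obtain M where M: "matching G M" "card M = matching_number G"
    using maximum_matching_exists[OF finG] by blast
  obtain N where N: "matching ?H N" "card N = matching_number ?H"
    using maximum_matching_exists[OF finH] by blast
  have disjN: "\<Union>N \<inter> set vs = {}"
    using N(1) by (auto simp: matching_def H undirected_def subset_iff)
  have finM: "finite M" and finN: "finite N"
    using M(1) N(1) finG finH by (auto simp: matching_def intro: finite_subset)
  have NG: "N \<subseteq> undirected ?R" and disjN': "pairwise disjnt N"
    using N(1) HG by (auto simp: matching_def edges_eq_undirected)

  obtain \<sigma>1 where \<sigma>1: "adjacency_perm ?R \<sigma>1" "card (moved \<sigma>1) = 2 * matching_number G"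
    using adjacency_perm_of_matching[OF finM sym irrefl] M by (auto simp: matching_def edges_eq_undirected)
  obtain \<sigma>2 where \<sigma>2: "adjacency_perm ?R \<sigma>2" "card (moved \<sigma>2) = l + 2 * matching_number ?H"
  proof -
    obtain \<tau> where \<tau>: "adjacency_perm ?R \<tau>" "moved \<tau> = \<Union>N" "card (moved \<tau>) = 2 * card N"
      using adjacency_perm_of_matching[OF finN sym irrefl NG disjN'] by blast
    have disj: "moved (cycle_of_list vs) \<inter> moved \<tau> = {}"
      using disjN by (auto simp: K.cycle_rotation(2) \<tau>(2))
    note comp = adjacency_perm_comp[OF K.cycle_rotation(1) \<tau>(1) disj]
    have "finite (moved \<tau>)" using moved_subset[OF \<tau>(1) sub] finite_verts by (rule finite_subset)
    then have "card (moved (cycle_of_list vs \<circ> \<tau>)) = l + 2 * matching_number ?H"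
      unfolding comp(2) using disj by (subst card_Un_disjoint) (auto simp: K.cycle_rotation(2) K.card_cycle l \<tau>(3) N(2))
    then show ?thesis using comp(1) that by blast
  qed
  \<comment> \<open>every second edge of the cycle extends a maximum matching of \<open>G - C\<close>\<close>
  have lower: "l div 2 + matching_number ?H \<le> matching_number G"
  proof -
    obtain L where L: "L \<subseteq> undirected ?R" "pairwise disjnt L" "card L = length vs div 2" "\<Union>L \<subseteq> set vs"
      using K.cycle_matching by blast
    have finL: "finite L" using L(1) finG by (auto simp: edges_eq_undirected intro: finite_subset)
    have "{} \<notin> L" using L(1) by (auto simp: undirected_def)
    have LN: "disjnt e f" if "e \<in> L" "f \<in> N" for e f
      using that L(4) disjN unfolding disjnt_def by blast
    have "L \<inter> N = {}"
    proof (rule equals0I)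
      fix e assume "e \<in> L \<inter> N"
      then show False using LN[of e e] \<open>{} \<notin> L\<close> by (auto simp: disjnt_def)
    qed
    then have "card (L \<union> N) = l div 2 + matching_number ?H"
      using finL finN L(3) N(2) l by (simp add: card_Un_disjoint)
    moreover have "pairwise disjnt (L \<union> N)"
    proof (rule pairwiseI)
      fix e f assume "e \<in> L \<union> N" "f \<in> L \<union> N" "e \<noteq> f"
      then show "disjnt e f"
        using LN[of e f] LN[of f e] pairwiseD[OF L(2), of e f] pairwiseD[OF disjN', of e f]
        by (auto simp: disjnt_sym)
    qed
    then have "matching G (L \<union> N)"
      using L(1) NG by (simp add: matching_def edges_eq_undirected)
    ultimately show ?thesis using maxG[of "L \<union> N"] by simp
  qed
  have upper: "card (moved \<tau>) \<le> 2 * matching_number G \<or> card (moved \<tau>) \<le> l + 2 * matching_number ?H"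
    if "adjacency_perm ?R \<tau>" for \<tau>
    using K.matching_bounds_adjacency_perm[OF conn' card[unfolded edges_eq_undirected] that]
  proof (elim disjE exE conjE)
    fix M' assume "M' \<subseteq> undirected ?R" "pairwise disjnt M'" "card (moved \<tau>) \<le> 2 * card M'"
    then show ?thesis using maxG[of M'] by (auto simp: matching_def edges_eq_undirected)
  next
    fix M' assume "M' \<subseteq> undirected (?R \<inter> (verts G - set vs) \<times> (verts G - set vs))" "pairwise disjnt M'"
      "card (moved \<tau>) \<le> length vs + 2 * card M'"
    then show ?thesis using maxH[of M'] l by (auto simp: matching_def H)
  qed
  have bound: "card (moved \<tau>) \<le> n" if "adjacency_perm ?R \<tau>" for \<tau>
    using moved_subset[OF that sub] finite_verts assms(2) by (auto intro: card_mono)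
  show ?thesis
  proof (cases "l + 2 * matching_number ?H \<le> 2 * matching_number G")
    case True
    have "per_nullity G = n - 2 * matching_number G"
      using per_nullity_eq_max_moved[OF G \<sigma>1(1)] upper True \<sigma>1(2) assms(2) by fastforce
    moreover have "2 * matching_number G \<le> n" using bound[OF \<sigma>1(1)] \<sigma>1(2) by simp
    moreover have "\<not> (odd l \<and> matching_number G = (l - 1) div 2 + matching_number ?H)"
      using True by (auto elim!: oddE)
    ultimately show ?thesis by auto
  next
    case False
    have "per_nullity G = n - (l + 2 * matching_number ?H)"
      using per_nullity_eq_max_moved[OF G \<sigma>2(1)] upper False \<sigma>2(2) assms(2) by fastforce
    moreover have "l + 2 * matching_number ?H \<le> n" using bound[OF \<sigma>2(1)] \<sigma>2(2) by simp
    moreover have "odd l \<and> matching_number G = (l - 1) div 2 + matching_number ?H"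
      using False lower by (cases "even l") (auto elim!: oddE evenE)
    ultimately show ?thesis by (auto elim!: oddE)
  qed
qed

end
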